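(* Let $T$ be an oscillatory tetradiagonal Hessenberg matrix. Then the following tetradiagonal Hessenberg matrices (all with first superdiagonal of ones and zero entries outside the listed bands) admit a PBF: - the matrix $\check T$ with diagonal $(b_1,b_2,b_3,\dots)$, first subdiagonal $(a_2c_1,\,a_3c_2,\,a_4c_3,\dots)$ and second subdiagonal $(a_2a_3,\,a_3a_4,\,a_4a_5,\dots)$; - for each $k\in\mathbb N$, the matrix $\check T^{[k]}$ with diagonal $(b_{k+1}-l_{k+1},\,b_{k+2},\,b_{k+3},\dots)$, first subdiagonal $(a_{k+2}c_{k+1},\,a_{k+3}c_{k+2},\,a_{k+4}c_{k+3},\dots)$ and second subdiagonal $(a_{k+2}a_{k+3},\,a_{k+3}a_{k+4},\dots)$.
   Context: A tetradiagonal Hessenberg matrix is a real semi-infinite matrix $T=(T_{i,j})_{i,j\ge0}$ with $T_{n,n+1}=1$, $T_{n,n}=c_n$ ($n\ge0$), $T_{n,n-1}=b_n$ ($n\ge1$), $T_{n,n-2}=a_n$ ($n\ge2$), all other entries $0$, and $a_n>0$ for all $n\ge2$. $T^{[N]}$ is the leading principal submatrix with rows and columns $0,\dots,N$. A finite matrix is TN if all its minors are nonnegative, and oscillatory if it is TN and some power of it has all minors positive (equivalently, TN, irreducible and nonsingular). A semi-infinite matrix is oscillatory if all its leading principal submatrices are. A PBF (positive bidiagonal factorization) of a tetradiagonal Hessenberg matrix is a factorization as a product $L_1L_2U$ where $L_1$ is lower unitriangular bidiagonal with first subdiagonal $(\alpha_2,\alpha_5,\alpha_8,\dots)$, $L_2$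 is lower unitriangular bidiagonal with first subdiagonal $(\alpha_3,\alpha_6,\alpha_9,\dots)$, $U$ is upper bidiagonal with diagonal $(\alpha_1,\alpha_4,\alpha_7,\dots)$ and first superdiagonal of ones, and $\alpha_j>0$ for all $j\in\mathbb N$. For $T$ oscillatory let $\delta^{[n]}=\det T^{[n]}>0$, $\delta^{[-1]}=1$. The Gauss--Borel factorization is the unique factorization $T=LU$ with $U$ upper bidiagonal with first superdiagonal of ones and diagonal $(\alpha_1,\alpha_4,\alpha_7,\dots)$, and $L$ lower unitriangular with $L_{n,n-1}=m_n$ ($n\ge1$), $L_{n,n-2}=l_n$ ($n\ge2$), other subdiagonal entries zero; explicitly $\alpha_{3n+1}=\delta^{[n]}/\delta^{[n-1]}$, $m_n=c_n-\alpha_{3n+1}$, $l_n=a_n/\alpha_{3n-5}=a_n\delta^{[n-3]}/\delta^{[n-2]}$. The numbers $l_{k+1}$ in the claim are those of $T$. *)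

theory Defs
  imports
    Complex_Main
    "Jordan_Normal_Form.Determinant"
    "Jordan_Normal_Form.DL_Submatrix"
begin

section \<open>Semi-infinite matrices\<close>

type_synonym semi_mat = "nat \<Rightarrow> nat \<Rightarrow> real"

text \<open>All products formed below have only finitely many nonzero terms in each entry, so that
  the series is a finite sum.\<close>

definition semi_mult :: "semi_mat \<Rightarrow> semi_mat \<Rightarrow> semi_mat" where
  "semi_mult A B = (\<lambda>i j. \<Sum>k. A i k * B k j)"

definition leading_principal :: "semi_mat \<Rightarrow> nat \<Rightarrow> real mat" where
  "leading_principal T N = mat (Suc N) (Suc N) (\<lambda>(i, j). T i j)"

text \<open>The values \<open>b 0\<close>, \<open>a 0\<close> and \<open>a 1\<close> do not occur in the matrix: row \<open>n\<close> carries
  \<open>a n\<close>, \<open>b n\<close>, \<open>c n\<close>, 1 in the columns \<open>n - 2\<close>, \<open>n - 1\<close>, \<open>n\<close>, \<open>n + 1\<close>.\<close>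

definition tetradiag :: "(nat \<Rightarrow> real) \<Rightarrow> (nat \<Rightarrow> real) \<Rightarrow> (nat \<Rightarrow> real) \<Rightarrow> semi_mat" where
  "tetradiag a b c = (\<lambda>i j.
     if j = i + 1 then 1
     else if j = i then c i
     else if i = j + 1 then b i
     else if i = j + 2 then a i
     else 0)"

definition tetradiagonal_Hessenberg :: "semi_mat \<Rightarrow> bool" where
  "tetradiagonal_Hessenberg T \<longleftrightarrow> (\<exists>a b c. T = tetradiag a b c \<and> (\<forall>n\<ge>2. 0 < a n))"

definition lower_unibidiagonal :: "(nat \<Rightarrow> real) \<Rightarrow> semi_mat" where
  "lower_unibidiagonal s = (\<lambda>i j. if i = j then 1 else if i = j + 1 then s j else 0)"

definition upper_bidiagonal :: "(nat \<Rightarrow> real) \<Rightarrow> semi_mat" where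
  "upper_bidiagonal d = (\<lambda>i j. if i = j then d i else if j = i + 1 then 1 else 0)"

section \<open>Total nonnegativity and oscillation\<close>

definition minors_nonneg :: "real mat \<Rightarrow> bool" where
  "minors_nonneg A \<longleftrightarrow>
     (\<forall>I J. I \<subseteq> {..<dim_row A} \<and> J \<subseteq> {..<dim_col A} \<and> card I = card J
        \<longrightarrow> 0 \<le> det (submatrix A I J))"

definition minors_pos :: "real mat \<Rightarrow> bool" where
  "minors_pos A \<longleftrightarrow>
     (\<forall>I J. I \<subseteq> {..<dim_row A} \<and> J \<subseteq> {..<dim_col A} \<and> card I = card J
        \<longrightarrow> 0 < det (submatrix A I J))"

text \<open>The zeroth power has to be excluded: it would make the \<open>1 \<times> 1\<close> zero matrix oscillatory.\<close>

definition oscillatory_mat :: "real mat \<Rightarrow> bool" where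
  "oscillatory_mat A \<longleftrightarrow>
     square_mat A \<and> minors_nonneg A \<and> (\<exists>p\<ge>1. minors_pos (A ^\<^sub>m p))"

definition oscillatory :: "semi_mat \<Rightarrow> bool" where
  "oscillatory T \<longleftrightarrow> (\<forall>N. oscillatory_mat (leading_principal T N))"

section \<open>Positive bidiagonal factorization\<close>

text \<open>The sequence \<open>\<alpha>\<close> is indexed from 1; \<open>\<alpha> 0\<close> is not used.\<close>

definition admits_PBF :: "semi_mat \<Rightarrow> bool" where
  "admits_PBF T \<longleftrightarrow>
     tetradiagonal_Hessenberg T \<and>
     (\<exists>\<alpha> :: nat \<Rightarrow> real. (\<forall>j\<ge>1. 0 < \<alpha> j) \<and>
        T = semi_mult
              (semi_mult (lower_unibidiagonal (\<lambda>n. \<alpha> (3 * n + 2)))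
                         (lower_unibidiagonal (\<lambda>n. \<alpha> (3 * n + 3))))
              (upper_bidiagonal (\<lambda>n. \<alpha> (3 * n + 1))))"

section \<open>Gauss--Borel factorization\<close>

definition gauss_borel :: "semi_mat \<Rightarrow> semi_mat \<Rightarrow> semi_mat \<Rightarrow> bool" where
  "gauss_borel T L U \<longleftrightarrow>
     (\<forall>i. L i i = 1) \<and> (\<forall>i j. i < j \<or> j + 2 < i \<longrightarrow> L i j = 0) \<and>
     (\<exists>d. U = upper_bidiagonal d) \<and>
     T = semi_mult L U"

text \<open>Existence and uniqueness of the factorization for oscillatory tetradiagonal Hessenberg
  matrices is proved in \<open>gauss_borel_ex1\<close> below.\<close>

definition gauss_borel_L :: "semi_mat \<Rightarrow> semi_mat" where
  "gauss_borel_L T = (THE L. \<exists>U. gauss_borel T L U)"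

definition gauss_borel_l :: "semi_mat \<Rightarrow> nat \<Rightarrow> real" where
  "gauss_borel_l T n = gauss_borel_L T n (n - 2)"

lemma semi_mult_upper_bidiagonal:
  "semi_mult A (upper_bidiagonal d) i j = A i j * d j + (if j = 0 then 0 else A i (j - 1))"
proof -
  have "(\<Sum>k. A i k * upper_bidiagonal d k j) = (\<Sum>k\<in>{j - 1, j}. A i k * upper_bidiagonal d k j)"
    by (rule suminf_finite) (auto simp: upper_bidiagonal_def)
  also have "\<dots> = A i j * d j + (if j = 0 then 0 else A i (j - 1))"
    by (cases j) (auto simp: upper_bidiagonal_def)
  finally show ?thesis by (simp add: semi_mult_def)
qed

lemma gauss_borel_tetradiag_iff:
  "gauss_borel (tetradiag a b c) L (upper_bidiagonal d) \<longleftrightarrow>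
     (\<forall>i. L i i = 1) \<and> (\<forall>i j. i < j \<or> j + 2 < i \<longrightarrow> L i j = 0) \<and>
     c 0 = d 0 \<and>
     (\<forall>n. c (n + 1) = d (n + 1) + L (n + 1) n) \<and>
     b 1 = L 1 0 * d 0 \<and>
     (\<forall>n. b (n + 2) = L (n + 2) (n + 1) * d (n + 1) + L (n + 2) n) \<and>
     (\<forall>n. a (n + 2) = L (n + 2) n * d n)"
    (is "?G \<longleftrightarrow> ?R")
proof
  assume ?G
  then have un: "\<And>i. L i i = 1" and band: "\<And>i j. i < j \<or> j + 2 < i \<Longrightarrow> L i j = 0"
    and T: "\<And>i j. tetradiag a b c i j = L i j * d j + (if j = 0 then 0 else L i (j - 1))"
    by (auto simp: gauss_borel_def semi_mult_upper_bidiagonal)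
  have "c 0 = d 0" using T[of 0 0] un by (simp add: tetradiag_def)
  moreover have "c (n + 1) = d (n + 1) + L (n + 1) n" for n
    using T[of "n + 1" "n + 1"] un[of "n + 1"] by (simp add: tetradiag_def)
  moreover have "b 1 = L 1 0 * d 0" using T[of 1 0] by (simp add: tetradiag_def)
  moreover have "b (n + 2) = L (n + 2) (n + 1) * d (n + 1) + L (n + 2) n" for n
    using T[of "n + 2" "n + 1"] by (simp add: tetradiag_def)
  moreover have "a (n + 2) = L (n + 2) n * d n" for n
    using T[of "n + 2" n] band[of "n - 1" "n + 2"] band[of "n + 2" "n - 1"]
    by (simp add: tetradiag_def split: if_splits)
  ultimately show ?R using un band by auto
next
  assume R: ?R
  then have un: "\<And>i. L i i = 1" and band: "\<And>i j. i < j \<or> j + 2 < i \<Longrightarrow> L i j = 0"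
    and c0: "c 0 = d 0" and c: "\<And>n. c (Suc n) = d (Suc n) + L (Suc n) n"
    and b1: "b (Suc 0) = L (Suc 0) 0 * d 0"
    and b: "\<And>n. b (Suc (Suc n)) = L (Suc (Suc n)) (Suc n) * d (Suc n) + L (Suc (Suc n)) n"
    and a: "\<And>n. a (Suc (Suc n)) = L (Suc (Suc n)) n * d n"
    by auto
  have "tetradiag a b c i j = L i j * d j + (if j = 0 then 0 else L i (j - 1))" for i j
  proof -
    consider "i + 1 < j" | "j = i + 1" | "i = j" | "i = j + 1" | "i = j + 2" | "j + 2 < i"
      by linarith
    then show ?thesis
    proof cases
      case 1
      then show ?thesis using band[of i j] band[of i "j - 1"] by (simp add: tetradiag_def)
    next
      case 2
      then show ?thesis using band[of i j] un by (simp add: tetradiag_def)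
    next
      case 3
      then show ?thesis using un[of j] c0 c by (cases j) (auto simp: tetradiag_def)
    next
      case 4
      then show ?thesis using b1 b by (cases j) (auto simp: tetradiag_def)
    next
      case 5
      then show ?thesis using a band[of i "j - 1"] by (auto simp: tetradiag_def)
    next
      case 6
      then show ?thesis using band[of i j] band[of i "j - 1"] by (auto simp: tetradiag_def)
    qed
  qed
  then show ?G
    using un band by (auto simp: gauss_borel_def fun_eq_iff semi_mult_upper_bidiagonal)
qed

lemma gauss_borel_unique:
  assumes a: "\<forall>n\<ge>2. 0 < a n"
    and G: "gauss_borel (tetradiag a b c) L U" and G': "gauss_borel (tetradiag a b c) L' U'"
  shows "L = L' \<and> U = U'"
proof -
  obtain d d' where U: "U = upper_bidiagonal d" and U': "U' = upper_bidiagonal d'"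
    using G G' by (auto simp: gauss_borel_def)
  note R = G[unfolded U gauss_borel_tetradiag_iff] and R' = G'[unfolded U' gauss_borel_tetradiag_iff]
  from R have un: "\<And>i. L i i = 1" and band: "\<And>i j. i < j \<or> j + 2 < i \<Longrightarrow> L i j = 0"
    and c0: "c 0 = d 0" and c: "\<And>n. c (n + 1) = d (n + 1) + L (n + 1) n"
    and b1: "b 1 = L 1 0 * d 0"
    and b: "\<And>n. b (n + 2) = L (n + 2) (n + 1) * d (n + 1) + L (n + 2) n"
    and aL: "\<And>n. a (n + 2) = L (n + 2) n * d n"
    by blast+
  from R' have un': "\<And>i. L' i i = 1" and band': "\<And>i j. i < j \<or> j + 2 < i \<Longrightarrow> L' i j = 0"
    and c0': "c 0 = d' 0" and c': "\<And>n. c (n + 1) = d' (n + 1) + L' (n + 1) n"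
    and b1': "b 1 = L' 1 0 * d' 0"
    and b': "\<And>n. b (n + 2) = L' (n + 2) (n + 1) * d' (n + 1) + L' (n + 2) n"
    and aL': "\<And>n. a (n + 2) = L' (n + 2) n * d' n"
    by blast+
  have nz: "d n \<noteq> 0" "d' n \<noteq> 0" for n
    using aL[of n] aL'[of n] a[rule_format, of "n + 2"] by fastforce+
  have l: "L (n + 2) n = a (n + 2) / d n" for n
    unfolding aL using nz(1)[of n] by simp
  have l': "L' (n + 2) n = a (n + 2) / d' n" for n
    unfolding aL' using nz(2)[of n] by simp
  have m0: "L 1 0 = b 1 / d 0" unfolding b1 using nz(1)[of 0] by simp
  have m0': "L' 1 0 = b 1 / d' 0" unfolding b1' using nz(2)[of 0] by simp
  have m: "L (n + 2) (n + 1) = (b (n + 2) - a (n + 2) / d n) / d (n + 1)" for n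
    unfolding b l[symmetric] using nz(1)[of "n + 1"] by simp
  have m': "L' (n + 2) (n + 1) = (b (n + 2) - a (n + 2) / d' n) / d' (n + 1)" for n
    unfolding b' l'[symmetric] using nz(2)[of "n + 1"] by simp
  have d: "d n = d' n" for n
  proof (induction n rule: less_induct)
    case (less n)
    consider "n = 0" | "n = 1" | k where "n = k + 2"
      by (metis One_nat_def add_2_eq_Suc' not0_implies_Suc)
    then show ?case
    proof cases
      case 1
      then show ?thesis using c0 c0' by simp
    next
      case 2
      then show ?thesis using c[of 0] c'[of 0] m0 m0' less.IH[of 0] by simp
    next
      case 3
      have "L (k + 2) (k + 1) = L' (k + 2) (k + 1)"
        unfolding m m' using 3 less.IH[of k] less.IH[of "k + 1"] by simp
      then show ?thesis using 3 c[of "k + 1"] c'[of "k + 1"] by simp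
    qed
  qed
  have "L i j = L' i j" for i j
  proof -
    consider "i < j \<or> j + 2 < i" | "i = j" | "i = j + 1" "j = 0"
      | k where "i = j + 1" "j = k + 1" | "i = j + 2"
    proof -
      have "(i < j \<or> j + 2 < i) \<or> i = j \<or> i = j + 1 \<or> i = j + 2" by linarith
      moreover have "j = 0 \<or> (\<exists>k. j = k + 1)" by (cases j) auto
      ultimately show ?thesis using that by blast
    qed
    then show ?thesis
    proof cases
      case 1
      then show ?thesis using band band' by simp
    next
      case 2
      then show ?thesis using un un' by simp
    next
      case 3
      then show ?thesis using m0 m0' d by simp
    next
      case 4
      then show ?thesis using m[of k] m'[of k] d by simp
    next
      case 5
      then show ?thesis using l[of j] l'[of j] d by simp
    qed
  qed
  moreover have "d = d'" using d by blast
  ultimately show ?thesis using U U' by blast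
qed

lemma det_pow_mat:
  assumes "(A :: real mat) \<in> carrier_mat n n"
  shows "det (A ^\<^sub>m p) = det A ^ p"
proof (induction p)
  case 0
  then show ?case using assms by simp
next
  case (Suc p)
  have "A ^\<^sub>m p \<in> carrier_mat n n" using assms by auto
  from det_mult[OF this assms] show ?case using Suc by (simp add: mult.commute)
qed

lemma submatrix_full: "submatrix A {..<dim_row A} {..<dim_col A} = A"
proof -
  have p: "pick {..<n} i = i" if "i < n" for n i :: nat
    using pick_card_in_set[of i "{..<n}"] that
    by (metis (no_types, lifting) Collect_cong card_Collect_less_nat lessThan_iff order.strict_trans)
  have "{i. i < n \<and> i \<in> {..<n}} = {..<n}" for n :: nat by auto
  then show ?thesis by (auto simp: submatrix_def p intro!: eq_matI)
qed

lemma oscillatory_det_pos: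
  assumes "oscillatory T"
  shows "0 < det (leading_principal T N)"
proof -
  let ?A = "leading_principal T N"
  have A: "?A \<in> carrier_mat (Suc N) (Suc N)" by (simp add: leading_principal_def)
  obtain p where p: "p \<ge> 1" "minors_pos (?A ^\<^sub>m p)" and tn: "minors_nonneg ?A"
    using assms by (auto simp: oscillatory_def oscillatory_mat_def)
  have "?A ^\<^sub>m p \<in> carrier_mat (Suc N) (Suc N)" using A by auto
  then have "dim_row (?A ^\<^sub>m p) = dim_col (?A ^\<^sub>m p)" by (simp only: carrier_matD)
  then have "0 < det (?A ^\<^sub>m p)"
    using p(2)[unfolded minors_pos_def, rule_format,
        of "{..<dim_row (?A ^\<^sub>m p)}" "{..<dim_col (?A ^\<^sub>m p)}"]
    unfolding submatrix_full by (simp only: card_lessThan subset_refl simp_thms)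
  then have "det ?A \<noteq> 0" using p(1) det_pow_mat[OF A, of p] by (auto simp: power_0_left)
  moreover have "0 \<le> det ?A"
    using tn[unfolded minors_nonneg_def, rule_format, of "{..<dim_row ?A}" "{..<dim_col ?A}"] A
    unfolding submatrix_full by auto
  ultimately show ?thesis by simp
qed

lemma det_leading_principal_LU:
  assumes un: "\<And>i. L i i = 1" and low: "\<And>i j. i < j \<Longrightarrow> L i j = 0"
    and T: "\<And>i j. i \<le> N \<Longrightarrow> j \<le> N \<Longrightarrow> T i j = semi_mult L (upper_bidiagonal d) i j"
  shows "det (leading_principal T N) = (\<Prod>i\<le>N. d i)"
proof -
  let ?L = "leading_principal L N" and ?U = "leading_principal (upper_bidiagonal d) N"
  have cL: "?L \<in> carrier_mat (Suc N) (Suc N)" and cU: "?U \<in> carrier_mat (Suc N) (Suc N)"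
    by (simp_all add: leading_principal_def)
  have "leading_principal T N = ?L * ?U"
  proof (rule eq_matI)
    fix i j assume ij: "i < dim_row (?L * ?U)" "j < dim_col (?L * ?U)"
    then have ij': "i \<le> N" "j \<le> N" using cL cU by auto
    have "(?L * ?U) $$ (i, j) = (\<Sum>k = 0..<Suc N. L i k * upper_bidiagonal d k j)"
      using ij' by (auto simp: leading_principal_def scalar_prod_def intro!: sum.cong)
    also have "\<dots> = (\<Sum>k. L i k * upper_bidiagonal d k j)"
      using ij' low by (intro suminf_finite[symmetric]) auto
    finally show "leading_principal T N $$ (i, j) = (?L * ?U) $$ (i, j)"
      using T[OF ij'] ij' by (simp add: semi_mult_def leading_principal_def)
  qed (simp_all add: leading_principal_def)
  then have "det (leading_principal T N) = det ?L * det ?U" using det_mult[OF cL cU] by simp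
  also have "det ?L = 1"
    by (subst det_lower_triangular[OF _ cL])
      (auto simp: leading_principal_def low un prod_list_diag_prod)
  also have "det ?U = (\<Prod>i\<le>N. d i)"
    by (subst det_upper_triangular[OF _ cU])
      (auto simp: leading_principal_def upper_bidiagonal_def prod_list_diag_prod
        atLeast0LessThan lessThan_Suc_atMost intro!: upper_triangularI)
  finally show ?thesis by simp
qed

lemma gauss_borel_det:
  assumes "gauss_borel T L (upper_bidiagonal d)"
  shows "det (leading_principal T N) = (\<Prod>i\<le>N. d i)"
  using assms by (intro det_leading_principal_LU[of L]) (auto simp: gauss_borel_def)

fun gb_diag :: "(nat \<Rightarrow> real) \<Rightarrow> (nat \<Rightarrow> real) \<Rightarrow> (nat \<Rightarrow> real) \<Rightarrow> nat \<Rightarrow> real" where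
  "gb_diag a b c 0 = c 0"
| "gb_diag a b c (Suc 0) = c 1 - b 1 / gb_diag a b c 0"
| "gb_diag a b c (Suc (Suc n)) =
     c (n + 2) - (b (n + 2) - a (n + 2) / gb_diag a b c n) / gb_diag a b c (Suc n)"

definition gb_lower :: "(nat \<Rightarrow> real) \<Rightarrow> (nat \<Rightarrow> real) \<Rightarrow> (nat \<Rightarrow> real) \<Rightarrow> semi_mat" where
  "gb_lower a b c = (\<lambda>i j.
     if i = j then 1
     else if i = j + 1 then c i - gb_diag a b c i
     else if i = j + 2 then a i / gb_diag a b c j
     else 0)"

lemma gb_entry:
  assumes "\<And>k. k < i \<Longrightarrow> gb_diag a b c k \<noteq> 0"
  shows "tetradiag a b c i j = semi_mult (gb_lower a b c) (upper_bidiagonal (gb_diag a b c)) i j"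
proof -
  let ?d = "gb_diag a b c"
  consider "i + 1 < j" | "j = i + 1" | "i = j" | "i = 1" "j = 0" | k where "i = k + 2" "j = k + 1"
    | "i = j + 2" | "j + 2 < i"
  proof -
    have "i + 1 < j \<or> j = i + 1 \<or> i = j \<or> i = j + 1 \<or> i = j + 2 \<or> j + 2 < i" by linarith
    moreover have "j = 0 \<or> (\<exists>k. j = k + 1)" by (cases j) auto
    moreover have "i = j + 1 \<Longrightarrow> j = k + 1 \<Longrightarrow> i = k + 2" for k by simp
    moreover have "i = j + 1 \<Longrightarrow> j = 0 \<Longrightarrow> i = 1" by simp
    ultimately show ?thesis using that by blast
  qed
  then show ?thesis
  proof cases
    case 4
    then show ?thesis using assms[of 0]
      by (simp add: semi_mult_upper_bidiagonal tetradiag_def gb_lower_def)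
  next
    case 5
    then show ?thesis using assms[of "k + 1"]
      by (simp add: semi_mult_upper_bidiagonal tetradiag_def gb_lower_def)
  next
    case 6
    then show ?thesis using assms[of j]
      by (simp add: semi_mult_upper_bidiagonal tetradiag_def gb_lower_def)
  qed (auto simp: semi_mult_upper_bidiagonal tetradiag_def gb_lower_def)
qed

lemma gauss_borel_exists:
  assumes osc: "oscillatory (tetradiag a b c)"
  shows "gauss_borel (tetradiag a b c) (gb_lower a b c) (upper_bidiagonal (gb_diag a b c))"
proof -
  have nz: "gb_diag a b c n \<noteq> 0" for n
  proof (induction n rule: less_induct)
    case (less n)
    have "det (leading_principal (tetradiag a b c) n) = (\<Prod>i\<le>n. gb_diag a b c i)"
    proof (rule det_leading_principal_LU)
      fix i j assume "i \<le> n" "j \<le> n"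
      then show "tetradiag a b c i j =
          semi_mult (gb_lower a b c) (upper_bidiagonal (gb_diag a b c)) i j"
        using less by (intro gb_entry) auto
    qed (auto simp: gb_lower_def)
    then have "(\<Prod>i\<le>n. gb_diag a b c i) \<noteq> 0" using oscillatory_det_pos[OF osc, of n] by (metis less_irrefl)
    then show ?case by auto
  qed
  have "tetradiag a b c = semi_mult (gb_lower a b c) (upper_bidiagonal (gb_diag a b c))"
    using gb_entry nz by blast
  then show ?thesis by (auto simp: gauss_borel_def gb_lower_def)
qed

lemma gauss_borel_ex1:
  assumes "\<forall>n\<ge>2. 0 < a n" and "oscillatory (tetradiag a b c)"
  shows "\<exists>!(L, U). gauss_borel (tetradiag a b c) L U"
  using gauss_borel_exists[OF assms(2)] gauss_borel_unique[OF assms(1), of b c] by blast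

lemma gauss_borel_L_eq:
  assumes "\<forall>n\<ge>2. 0 < a n" and "gauss_borel (tetradiag a b c) L U"
  shows "gauss_borel_L (tetradiag a b c) = L"
  unfolding gauss_borel_L_def using assms gauss_borel_unique[OF assms(1), of b c] by blast

text \<open>The leading principal minor of index \<open>n - 3\<close> is read as 1 for \<open>n = 2\<close>.\<close>

lemma gauss_borel_l_explicit:
  assumes a: "\<forall>n\<ge>2. 0 < a n" and osc: "oscillatory (tetradiag a b c)" and n: "2 \<le> n"
  shows "gauss_borel_l (tetradiag a b c) n =
    a n * (if n = 2 then 1 else det (leading_principal (tetradiag a b c) (n - 3)))
      / det (leading_principal (tetradiag a b c) (n - 2))"
proof -
  note G = gauss_borel_exists[OF osc]
  obtain k where k: "n = k + 2" using n by (metis add.commute le_Suc_ex)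
  note D = gauss_borel_det[OF G]
  have nz: "(\<Prod>i\<le>m. gb_diag a b c i) \<noteq> 0" for m
    using oscillatory_det_pos[OF osc, of m] D[of m] by (metis less_irrefl)
  have "gauss_borel_l (tetradiag a b c) n = a n / gb_diag a b c k"
    using k by (simp add: gauss_borel_l_def gauss_borel_L_eq[OF a G] gb_lower_def)
  then show ?thesis using k nz[of "k - 1"] by (cases k) (auto simp: D)
qed

end

theory Submission
  imports Defs
begin

text \<open>Deleting the first row of \<open>T = L U\<close> gives \<open>J U\<close>, where \<open>J\<close> is the tridiagonal matrix with
  superdiagonal of ones, diagonal \<open>m\<close> and subdiagonal \<open>l\<close>. Total nonnegativity of \<open>T\<close> makes the
  continuants \<open>det J\<^sub>n\<close> nonnegative, and they cannot vanish: \<open>det J\<^sub>n = 0\<close> would force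
  \<open>det J\<^sub>n\<^sub>+\<^sub>1 = - l det J\<^sub>n\<^sub>-\<^sub>1 < 0\<close>. Hence \<open>J = A B\<close> with positive bidiagonal \<open>A\<close> and \<open>B\<close>, and the
  matrix of the theorem is, up to conjugation by a positive diagonal matrix,
  \<open>(J U)\<^sup>T = U\<^sup>T B\<^sup>T A\<^sup>T\<close>. Truncating the first \<open>k\<close> rows and columns of \<open>J\<close> and \<open>U\<close> gives the
  matrices for \<open>k \<ge> 1\<close>; the pivots of the truncated \<open>J\<close> dominate those of \<open>J\<close>.\<close>

section \<open>Continuants\<close>

text \<open>Expansion along the last row leaves two terms. The minor of the off-diagonal one has at
  most one nonzero entry in its last column, and expanding along that column leaves the block of
  size \<open>n\<close>.\<close>

lemma det_bordered_tridiagonal: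
  fixes J :: "nat \<Rightarrow> nat \<Rightarrow> 'a::comm_ring_1"
  assumes row: "\<And>j. j < n \<Longrightarrow> J (Suc n) j = 0" and col: "\<And>i. i < n \<Longrightarrow> J i (Suc n) = 0"
  shows "det (mat (Suc (Suc n)) (Suc (Suc n)) (\<lambda>(i, j). J i j)) =
    J (Suc n) (Suc n) * det (mat (Suc n) (Suc n) (\<lambda>(i, j). J i j)) -
    J (Suc n) n * J n (Suc n) * det (mat n n (\<lambda>(i, j). J i j))"
proof -
  let ?P = "\<lambda>k. mat k k (\<lambda>(i, j). J i j)"
  let ?A = "?P (Suc (Suc n))"
  let ?B = "mat_delete ?A (Suc n) n"
  have B: "?B \<in> carrier_mat (Suc n) (Suc n)"
    by (simp add: mat_delete_def)
  have Bn: "?B $$ (i, n) = (if i = n then J n (Suc n) else 0)" if "i < Suc n" for i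
    using that col by (auto simp: mat_delete_def less_Suc_eq)
  have del: "mat_delete ?B n n = ?P n"
    by (rule eq_matI) (auto simp: mat_delete_def)
  have "det ?B = (\<Sum>i<Suc n. ?B $$ (i, n) * cofactor ?B i n)"
    by (rule laplace_expansion_column[OF B]) simp
  also have "\<dots> = J n (Suc n) * det (?P n)"
    using Bn[of n] by (simp add: Bn cofactor_def del flip: mult_2)
  finally have detB: "det ?B = J n (Suc n) * det (?P n)" .
  have del': "mat_delete ?A (Suc n) (Suc n) = ?P (Suc n)"
    by (rule eq_matI) (auto simp: mat_delete_def)
  have "det ?A = (\<Sum>j<Suc (Suc n). ?A $$ (Suc n, j) * cofactor ?A (Suc n) j)"
    by (rule laplace_expansion_row) simp_all
  also have "\<dots> = J (Suc n) n * cofactor ?A (Suc n) n +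
      J (Suc n) (Suc n) * cofactor ?A (Suc n) (Suc n)"
    by (simp add: row)
  finally show ?thesis
    by (simp add: cofactor_def del' detB algebra_simps flip: mult_2)
qed

lemma nonneg_continuants_pos:
  fixes D m l :: "nat \<Rightarrow> real"
  assumes "D 0 = 1" and nonneg: "\<And>n. 0 \<le> D n" and l: "\<And>n. 0 < l n"
    and rec: "\<And>n. D (Suc (Suc n)) = m (Suc n) * D (Suc n) - l n * D n"
  shows "0 < D n"
proof (induction n)
  case (Suc n)
  have "D (Suc n) \<noteq> 0"
  proof
    assume "D (Suc n) = 0"
    then have "D (Suc (Suc n)) < 0" using rec[of n] l[of n] Suc by simp
    then show False using nonneg[of "Suc (Suc n)"] by simp
  qed
  then show ?case using nonneg[of "Suc n"] by simp
qed (simp add: assms(1))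

text \<open>Elimination pivots of the tridiagonal matrix with superdiagonal of ones, diagonal
  \<open>m\<close> and subdiagonal \<open>l\<close>: quotients of consecutive continuants, as long
  as these are nonzero.\<close>

fun pivot :: "(nat \<Rightarrow> real) \<Rightarrow> (nat \<Rightarrow> real) \<Rightarrow> nat \<Rightarrow> real" where
  "pivot m l 0 = m 0"
| "pivot m l (Suc n) = m (Suc n) - l n / pivot m l n"

text \<open>For \<open>l > 0\<close> the map from \<open>x\<close> to \<open>m - l / x\<close>
  increases on \<open>x > 0\<close>, so domination of the pivots propagates. It holds initially
  because for \<open>k > 0\<close> the old pivot is \<open>m k\<close> minus a positive
  quotient.\<close>

lemma pivot_shift_pos:
  assumes pos: "\<And>n. 0 < pivot m l n" and l: "\<And>n. 0 < l n"
  shows "0 < pivot (\<lambda>n. m (k + n)) (\<lambda>n. l (k + n)) n"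
proof -
  have "pivot m l (k + n) \<le> pivot (\<lambda>n. m (k + n)) (\<lambda>n. l (k + n)) n"
  proof (induction n)
    case 0
    show ?case
    proof (cases k)
      case (Suc j)
      then show ?thesis using l[of j] pos[of j] by simp
    qed simp
  next
    case (Suc n)
    have "l (k + n) / pivot (\<lambda>n. m (k + n)) (\<lambda>n. l (k + n)) n \<le> l (k + n) / pivot m l (k + n)"
      using Suc l[of "k + n"] pos[of "k + n"] by (intro divide_left_mono) auto
    then show ?case by simp
  qed
  then show ?thesis using pos[of "k + n"] by linarith
qed

section \<open>The minors of an oscillatory matrix without its first row\<close>

lemma pick_atLeast1AtMost: "i < n \<Longrightarrow> pick {1..n} i = Suc i"
proof (induction i)
  case 0
  then show ?case by (auto intro!: Least_equality)
next
  case (Suc i)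
  then show ?case by (auto intro!: Least_equality)
qed

lemma pick_lessThan: "i < n \<Longrightarrow> pick {..<n} i = i"
proof (induction i)
  case 0
  then show ?case by (auto intro!: Least_equality)
next
  case (Suc i)
  then show ?case by (auto intro!: Least_equality)
qed

lemma oscillatory_first_row_deleted_minor:
  assumes "oscillatory T"
  shows "0 \<le> det (mat n n (\<lambda>(i, j). T (Suc i) j))"
proof -
  \<comment> \<open>This matrix has size \<open>n + 1\<close>, so it contains the rows
    \<open>1..n\<close>.\<close>
  let ?A = "leading_principal T n"
  have "{i. i < Suc n \<and> i \<in> {1..n}} = {1..n}" "{i. i < Suc n \<and> i \<in> {..<n}} = {..<n}"
    by auto
  then have "submatrix ?A {1..n} {..<n} = mat n n (\<lambda>(i, j). T (Suc i) j)"
    by (intro eq_matI)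
      (auto simp: submatrix_def leading_principal_def pick_atLeast1AtMost pick_lessThan
        simp del: One_nat_def)
  moreover have "0 \<le> det (submatrix ?A {1..n} {..<n})"
  proof -
    have "minors_nonneg ?A" using assms by (simp add: oscillatory_def oscillatory_mat_def)
    then show ?thesis
      unfolding minors_nonneg_def
      by (elim allE[of _ "{1..n}"] allE[of _ "{..<n}"] impE) (auto simp: leading_principal_def)
  qed
  ultimately show ?thesis by simp
qed

text \<open>Column \<open>j\<close> of the right factor vanishes below row \<open>j\<close>, so
  truncation commutes with the product for every \<open>A\<close>. This matters because
  \<open>L\<close> without its first row is no longer lower triangular.\<close>

lemma det_times_upper_bidiagonal:
  "det (mat n n (\<lambda>(i, j). semi_mult A (upper_bidiagonal d) i j)) =
    det (mat n n (\<lambda>(i, j). A i j)) * (\<Prod>i<n. d i)"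
proof -
  let ?A = "mat n n (\<lambda>(i, j). A i j)" and ?U = "mat n n (\<lambda>(i, j). upper_bidiagonal d i j)"
  have "mat n n (\<lambda>(i, j). semi_mult A (upper_bidiagonal d) i j) = ?A * ?U"
  proof (rule eq_matI)
    fix i j assume "i < dim_row (?A * ?U)" "j < dim_col (?A * ?U)"
    then have ij: "i < n" "j < n" by auto
    have "(?A * ?U) $$ (i, j) = (\<Sum>k = 0..<n. A i k * upper_bidiagonal d k j)"
      using ij by (auto simp: scalar_prod_def intro!: sum.cong)
    also have "\<dots> = (\<Sum>k. A i k * upper_bidiagonal d k j)"
      using ij by (intro suminf_finite[symmetric]) (auto simp: upper_bidiagonal_def)
    finally show "mat n n (\<lambda>(i, j). semi_mult A (upper_bidiagonal d) i j) $$ (i, j) =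
        (?A * ?U) $$ (i, j)"
      using ij by (simp add: semi_mult_def)
  qed simp_all
  moreover have "det (?A * ?U) = det ?A * det ?U"
    by (rule det_mult) auto
  moreover have "det ?U = (\<Prod>i<n. d i)"
    by (subst det_upper_triangular[of _ n])
      (auto simp: upper_bidiagonal_def prod_list_diag_prod atLeast0LessThan
        intro!: upper_triangularI)
  ultimately show ?thesis by simp
qed

lemma gauss_borel_pivots_pos:
  assumes osc: "oscillatory T" and G: "gauss_borel T L (upper_bidiagonal d)"
    and d: "\<And>n. 0 < d n" and l: "\<And>n. 0 < L (n + 2) n"
  shows "0 < pivot (\<lambda>n. L (n + 1) n) (\<lambda>n. L (n + 2) n) n"
proof -
  let ?D = "\<lambda>n. det (mat n n (\<lambda>(i, j). L (Suc i) j))"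
  let ?piv = "pivot (\<lambda>n. L (n + 1) n) (\<lambda>n. L (n + 2) n)"
  from G have un: "\<And>i. L i i = 1" and band: "\<And>i j. i < j \<or> j + 2 < i \<Longrightarrow> L i j = 0"
    and T: "T = semi_mult L (upper_bidiagonal d)"
    by (auto simp: gauss_borel_def)
  have nonneg: "0 \<le> ?D n" for n
  proof -
    have "(\<lambda>i j. T (Suc i) j) = semi_mult (\<lambda>i j. L (Suc i) j) (upper_bidiagonal d)"
      by (simp add: T semi_mult_def fun_eq_iff)
    then have "0 \<le> ?D n * (\<Prod>i<n. d i)"
      using oscillatory_first_row_deleted_minor[OF osc, of n]
        det_times_upper_bidiagonal[of n "\<lambda>i j. L (Suc i) j" d] by metis
    moreover have "0 < (\<Prod>i<n. d i)" using d by (simp add: prod_pos)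
    ultimately show ?thesis by (simp add: zero_le_mult_iff)
  qed
  \<comment> \<open>The unit diagonal of \<open>L\<close> has become the superdiagonal of the
    shifted matrix.\<close>
  have rec: "?D (Suc (Suc n)) = L (Suc n + 1) (Suc n) * ?D (Suc n) - L (n + 2) n * ?D n" for n
    using det_bordered_tridiagonal[of n "\<lambda>i j. L (Suc i) j"] band un by simp
  have D: "0 < ?D n" for n
    using nonneg_continuants_pos[of ?D "\<lambda>n. L (n + 2) n" "\<lambda>n. L (n + 1) n" n] nonneg rec l
    by simp
  have "?piv n = ?D (Suc n) / ?D n"
  proof (induction n)
    case 0
    show ?case by (simp add: det_single)
  next
    case (Suc n)
    have "?piv (Suc n) = L (Suc n + 1) (Suc n) - L (n + 2) n / (?D (Suc n) / ?D n)"
      using Suc by simp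
    also have "\<dots> = (L (Suc n + 1) (Suc n) * ?D (Suc n) - L (n + 2) n * ?D n) / ?D (Suc n)"
      using D[of n] D[of "Suc n"] by (simp add: field_simps)
    finally show ?case by (simp only: rec)
  qed
  then show ?thesis using D[of n] D[of "Suc n"] by simp
qed

section \<open>The factorization\<close>

lemma semi_mult_lower_unibidiagonal:
  "semi_mult (lower_unibidiagonal s) (lower_unibidiagonal t) i j =
    (if i = j then 1 else if i = j + 1 then s j + t j
     else if i = j + 2 then s (j + 1) * t j else 0)"
proof -
  have "(\<Sum>k. lower_unibidiagonal s i k * lower_unibidiagonal t k j) =
      (\<Sum>k\<in>{j, j + 1}. lower_unibidiagonal s i k * lower_unibidiagonal t k j)"
    by (rule suminf_finite) (auto simp: lower_unibidiagonal_def)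
  then show ?thesis by (auto simp: semi_mult_def lower_unibidiagonal_def)
qed

text \<open>Transposing \<open>J U\<close> and conjugating by the diagonal matrix with
  \<open>s (n + 1) = s n * l n * d n\<close> turns the superdiagonal into ones and yields
  \<open>tetradiag A B C\<close>. Moving the diagonals of the transposed factors to the right gives
  the subdiagonal \<open>l\<close> from \<open>U\<close>, the subdiagonal \<open>t\<close> from the
  upper factor of \<open>J\<close>, and the diagonal \<open>u\<close>.\<close>

lemma admits_PBF_transposed_product:
  assumes d: "\<And>n. 0 < d n" and l: "\<And>n. 0 < l n" and z: "\<And>n. 0 < pivot m l n"
    and C0: "C 0 = m 0 * d 0" and C: "\<And>n. C (n + 1) = m (n + 1) * d (n + 1) + l n"
    and B: "\<And>n. B (n + 1) = l n * d n * (m n + d (n + 1))"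
    and A: "\<And>n. A (n + 2) = l n * d n * (l (n + 1) * d (n + 1))"
  shows "admits_PBF (tetradiag A B C)"
proof -
  let ?z = "pivot m l"
  define t where "t = (\<lambda>n. d (n + 1) * l n / ?z n)"
  define u where "u = (\<lambda>n. d n * ?z n)"
  \<comment> \<open>The three sequences are interleaved by residue mod 3. The shift by one occurs
    since \<open>3 * n + 3\<close> has quotient \<open>n + 1\<close>; at 0 truncated subtraction
    gives \<open>t 0\<close>, so positivity holds for every index.\<close>
  define \<alpha> where "\<alpha> = (\<lambda>j. if j mod 3 = 1 then u (j div 3)
    else if j mod 3 = 2 then l (j div 3) else t (j div 3 - 1))"
  have \<alpha>: "(\<lambda>n. \<alpha> (3 * n + 2)) = l" "(\<lambda>n. \<alpha> (3 * n + 3)) = t" "(\<lambda>n. \<alpha> (3 * n + 1)) = u"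
  proof -
    have "\<alpha> (3 * n + 2) = l n \<and> \<alpha> (3 * n + 3) = t n \<and> \<alpha> (3 * n + 1) = u n" for n
    proof -
      have "(3 * n + 2) mod 3 = 2" "(3 * n + 2) div 3 = n" "(3 * n + 3) mod 3 = 0"
        "(3 * n + 3) div 3 = n + 1" "(3 * n + 1) mod 3 = 1" "(3 * n + 1) div 3 = n"
        by presburger+
      then show ?thesis unfolding \<alpha>_def by (simp only:) simp
    qed
    then show "(\<lambda>n. \<alpha> (3 * n + 2)) = l" "(\<lambda>n. \<alpha> (3 * n + 3)) = t"
      "(\<lambda>n. \<alpha> (3 * n + 1)) = u" by blast+
  qed
  have pos: "0 < \<alpha> j" for j
    using d l z by (simp add: \<alpha>_def t_def u_def)
  let ?L = "semi_mult (lower_unibidiagonal l) (lower_unibidiagonal t)"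
  note L = semi_mult_lower_unibidiagonal
  have z0: "?z n \<noteq> 0" for n using z[of n] by simp
  \<comment> \<open>The product of the two lower factors has the band shape of a Gauss-Borel factor,
    so the entrywise criterion applies.\<close>
  have "gauss_borel (tetradiag A B C) ?L (upper_bidiagonal u)"
    unfolding gauss_borel_tetradiag_iff
  proof (intro conjI allI impI)
    show "C (n + 1) = u (n + 1) + ?L (n + 1) n" for n
      using z0[of n] by (simp add: C[of n, simplified] L t_def u_def field_simps)
    show "B 1 = ?L 1 0 * u 0"
      using z0[of 0] B[of 0] by (simp add: L t_def u_def field_simps)
    \<comment> \<open>The pivot at \<open>n + 1\<close> stays folded until the denominators are
      cleared; its recursion then matches the two sides.\<close>
    show "B (n + 2) = ?L (n + 2) (n + 1) * u (n + 1) + ?L (n + 2) n" for n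
      using z0[of n] z0[of "Suc n"] B[of "n + 1"]
      by (simp add: L t_def u_def divide_simps del: pivot.simps)
        (simp add: field_simps)
    show "A (n + 2) = ?L (n + 2) n * u n" for n
      using z0[of n] A[of n] by (simp add: L t_def u_def field_simps)
  qed (auto simp: L C0 u_def)
  then have "tetradiag A B C = semi_mult ?L (upper_bidiagonal u)"
    by (simp add: gauss_borel_def)
  moreover have "tetradiagonal_Hessenberg (tetradiag A B C)"
  proof -
    have "0 < A n" if n: "2 \<le> n" for n
    proof -
      obtain k where "n = 2 + k" using le_Suc_ex[OF n] by blast
      then show ?thesis using A[of k] l d by simp
    qed
    then show ?thesis unfolding tetradiagonal_Hessenberg_def by blast
  qed
  ultimately show ?thesis
    unfolding admits_PBF_def
  proof (intro conjI exI[of _ \<alpha>])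
    show "\<forall>j\<ge>1. 0 < \<alpha> j" using pos by blast
  qed (simp_all only: \<alpha>)
qed

theorem theorem13:
  fixes a b c :: "nat \<Rightarrow> real"
  assumes "\<forall>n\<ge>2. 0 < a n"
    and "oscillatory (tetradiag a b c)"
  shows "admits_PBF (tetradiag
           (\<lambda>n. a n * a (n + 1))
           (\<lambda>n. a (n + 1) * c n)
           (\<lambda>n. b (n + 1)))
    \<and> (\<forall>k\<ge>1. admits_PBF (tetradiag
           (\<lambda>n. a (k + n) * a (k + n + 1))
           (\<lambda>n. a (k + n + 1) * c (k + n))
           (\<lambda>n. if n = 0 then b (k + 1) - gauss_borel_l (tetradiag a b c) (k + 1)
                else b (k + n + 1))))"
proof -
  define L where "L = gb_lower a b c"
  define d where "d = gb_diag a b c"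
  define m where "m = (\<lambda>n. L (n + 1) n)"
  define l where "l = (\<lambda>n. L (n + 2) n)"
  have G: "gauss_borel (tetradiag a b c) L (upper_bidiagonal d)"
    unfolding L_def d_def by (rule gauss_borel_exists[OF assms(2)])
  from G[unfolded gauss_borel_tetradiag_iff]
  have c: "\<And>n. c (n + 1) = d (n + 1) + m n" and b1: "b 1 = m 0 * d 0"
    and b: "\<And>n. b (n + 2) = m (n + 1) * d (n + 1) + l n"
    and al: "\<And>n. a (n + 2) = l n * d n"
    by (auto simp: m_def l_def)
  have d: "0 < d n" for n
  proof -
    \<comment> \<open>Each \<open>d n\<close> is a quotient of consecutive leading principal
      minors.\<close>
    have P: "0 < (\<Prod>i\<le>n. d i)" for n
      using oscillatory_det_pos[OF assms(2), of n] gauss_borel_det[OF G, of n] by simp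
    show ?thesis
    proof (cases n)
      case (Suc k)
      then show ?thesis using P[of k] P[of n] by (simp add: zero_less_mult_iff)
    qed (use P[of 0] in simp)
  qed
  have l: "0 < l n" for n
    using al[of n] assms(1)[rule_format, of "n + 2"] d[of n] by (simp add: zero_less_mult_iff)
  have pivot: "0 < pivot m l n" for n
    using gauss_borel_pivots_pos[OF assms(2) G d, of n] l by (simp add: m_def l_def)
  \<comment> \<open>Only the corner distinguishes the two claims: truncation at \<open>k\<close>
    leaves \<open>m k * d k\<close> there, and \<open>k = 0\<close> is the case without
    truncation.\<close>
  have "admits_PBF (tetradiag (\<lambda>n. a (k + n) * a (k + n + 1)) (\<lambda>n. a (k + n + 1) * c (k + n)) C)"
    if "C 0 = m k * d k" and "\<And>n. C (n + 1) = b (k + n + 2)" for k C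
  proof (rule admits_PBF_transposed_product[where d = "\<lambda>n. d (k + n)" and m = "\<lambda>n. m (k + n)"
        and l = "\<lambda>n. l (k + n)"])
    show "0 < pivot (\<lambda>n. m (k + n)) (\<lambda>n. l (k + n)) n" for n
      by (rule pivot_shift_pos[OF pivot l])
    show "C (n + 1) = m (k + (n + 1)) * d (k + (n + 1)) + l (k + n)" for n
      using that(2)[of n] b[of "k + n"] by simp
    show "a (k + (n + 1) + 1) * c (k + (n + 1)) = l (k + n) * d (k + n) * (m (k + n) + d (k + (n + 1)))"
      for n
      using al[of "k + n"] c[of "k + n"] by simp
    show "a (k + (n + 2)) * a (k + (n + 2) + 1) =
        l (k + n) * d (k + n) * (l (k + (n + 1)) * d (k + (n + 1)))" for n
      using al[of "k + n"] al[of "k + n + 1"] by simp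
  qed (use that d l in simp_all)
  note PBF = this
  have "gauss_borel_l (tetradiag a b c) (j + 2) = l j" for j
    by (simp add: gauss_borel_l_def gauss_borel_L_eq[OF assms(1) G] l_def)
  \<comment> \<open>Here \<open>l\<close> is indexed by column, so the subtracted number is
    \<open>l (k - 1)\<close>, the contribution to \<open>b (k + 1)\<close> of the index
    \<open>k - 1\<close> that truncation removes.\<close>
  then have "b (k + 1) - gauss_borel_l (tetradiag a b c) (k + 1) = m k * d k" if "k \<ge> 1" for k
    using b[of "k - 1"] that by (cases k) simp_all
  then have "admits_PBF (tetradiag (\<lambda>n. a (k + n) * a (k + n + 1)) (\<lambda>n. a (k + n + 1) * c (k + n))
      (\<lambda>n. if n = 0 then b (k + 1) - gauss_borel_l (tetradiag a b c) (k + 1) else b (k + n + 1)))"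
    if "k \<ge> 1" for k
    using that by (intro PBF) simp_all
  moreover have "admits_PBF (tetradiag (\<lambda>n. a n * a (n + 1)) (\<lambda>n. a (n + 1) * c n) (\<lambda>n. b (n + 1)))"
    using PBF[of "\<lambda>n. b (n + 1)" 0] b1 by simp
  ultimately show ?thesis by blast
qed

end
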